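(* Let $X=\{X(t),t\ge 0\}$ be a real-valued additive process whose increments satisfy $$\mathbb{E}e^{ip(X(t)-X(s))}=\exp\Big(\int_s^t\eta(p,\tau)\,d\tau\Big),\qquad 0\le s\le t,\ p\in\mathbb{R},$$ where, for each $t\ge 0$, $$\eta(p,t)=ib_tp-\tfrac12 z_tp^2+\int_{\mathbb{R}}\big(e^{ipy}-1-ipy\,1_{[-1,1]}(y)\big)\nu_t(dy),$$ with $b_t\in\mathbb{R}$, $z_t\ge 0$ and $\nu_t$ a Lévy measure. Assume that $t\mapsto\eta(p,t)$ is continuous and that $|\eta(p,t)|$ is bounded in $t$ (for each $p\in\mathbb{R}$). Let $T_{s,t}$ be the propagator associated with $X$ and let $\mathcal{A}_t$ be its time-dependent generator. Then, for every $f\in\mathcal{S}(\mathbb{R})$: (i) for $0\le s\le t$ and $x\in\mathbb{R}$, $$T_{s,t}f(x)=\frac1{\sqrt{2\pi}}\int_{\mathbb{R}}e^{ipx}e^{\int_s^t\eta(p,\tau)d\tau}\tilde f(p)\,dp;$$ (ii) for $t\ge 0$ and $x\in\mathbb{R}$, the time-dependent generator has the form $$\mathcal{A}_tf(x)=\frac1{\sqrt{2\pi}}\int_{\mathbb{R}}e^{ipx}\eta(p,t)\tilde f(p)\,dp;$$ (iii) equivalently, $$\mathcal{A}_tf(x)=\tfrac12 z_tf''(x)+b_tf'(x)+\int_{\mathbb{R}}\big[f(x+y)-f(x)-yf'(x)1_{\{|y|\le1\}}\big]\nu_t(dy).$$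
   Context: An additive process is a stochastically continuous process $X$ with $X(0)=0$ a.s. and independent (not necessarily stationary) increments. A Lévy measure $\nu_t$ is a Borel measure on $\mathbb{R}$ with $\nu_t(\{0\})=0$ and $\int_{\mathbb{R}}(y^2\wedge1)\nu_t(dy)<\infty$. Let $p_{s,t}$ be the law of $X(t)-X(s)$ (equal to the transition probability $P(X(t)\in d(x+y)\mid X(s)=x)$, which does not depend on $x$). The propagator is $T_{s,t}f(x)=\int_{\mathbb{R}}f(x+y)\,p_{s,t}(dy)$, $0\le s\le t$. The time-dependent generator is $\mathcal{A}_tf=\lim_{h\to0^+}\frac{T_{t,t+h}f-f}{h}$, the limit being taken in the sup-norm. $\mathcal{S}(\mathbb{R})$ is the Schwartz space and $\tilde f(p)=\frac1{\sqrt{2\pi}}\int_{\mathbb{R}}e^{-ipx}f(x)\,dx$. *)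

theory Defs
  imports "HOL-Probability.Probability"
begin

text \<open>
  The time index of a process is a real number, but only nonnegative times are constrained.
\<close>

locale additive_process = prob_space M
  for M :: "'a measure" and X :: "real \<Rightarrow> 'a \<Rightarrow> real" +
  assumes rv: "\<And>t. 0 \<le> t \<Longrightarrow> random_variable borel (X t)"
    and start: "AE \<omega> in M. X 0 \<omega> = 0"
    and indep_increments: "\<And>(n::nat) (t :: nat \<Rightarrow> real).
      0 \<le> t 0 \<Longrightarrow> (\<And>i. i < n \<Longrightarrow> t i < t (Suc i)) \<Longrightarrow>
      indep_vars (\<lambda>_. borel) (\<lambda>i \<omega>. X (t (Suc i)) \<omega> - X (t i) \<omega>) {..<n}"
    and stochastically_continuous: "\<And>t \<epsilon>. 0 \<le> t \<Longrightarrow> 0 < \<epsilon> \<Longrightarrow>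
      ((\<lambda>s. prob {\<omega> \<in> space M. \<epsilon> < \<bar>X s \<omega> - X t \<omega>\<bar>}) \<longlongrightarrow> 0) (at t within {0..})"

definition levy_measure :: "real measure \<Rightarrow> bool" where
  "levy_measure \<nu> \<longleftrightarrow> sets \<nu> = sets borel \<and> emeasure \<nu> {0} = 0 \<and>
     (\<integral>\<^sup>+ y. ennreal (min (y\<^sup>2) 1) \<partial>\<nu>) < \<infinity>"

definition increment_law :: "'a measure \<Rightarrow> (real \<Rightarrow> 'a \<Rightarrow> real) \<Rightarrow> real \<Rightarrow> real \<Rightarrow> real measure" where
  "increment_law M X s t = distr M borel (\<lambda>\<omega>. X t \<omega> - X s \<omega>)"

definition propagator ::
  "'a measure \<Rightarrow> (real \<Rightarrow> 'a \<Rightarrow> real) \<Rightarrow> real \<Rightarrow> real \<Rightarrow> (real \<Rightarrow> complex) \<Rightarrow> real \<Rightarrow> complex" where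
  "propagator M X s t f x = (LINT y|increment_law M X s t. f (x + y))"

text \<open>
  Convergence in the sup-norm is uniform convergence on the whole line.  The generator is
  meaningful only on its domain, where the limit exists and is unique.
\<close>

definition has_generator_value ::
  "'a measure \<Rightarrow> (real \<Rightarrow> 'a \<Rightarrow> real) \<Rightarrow> real \<Rightarrow> (real \<Rightarrow> complex) \<Rightarrow> (real \<Rightarrow> complex) \<Rightarrow> bool" where
  "has_generator_value M X t f g \<longleftrightarrow>
     uniform_limit UNIV (\<lambda>h x. (propagator M X t (t + h) f x - f x) / complex_of_real h) g (at_right 0)"

definition generator_domain ::
  "'a measure \<Rightarrow> (real \<Rightarrow> 'a \<Rightarrow> real) \<Rightarrow> real \<Rightarrow> (real \<Rightarrow> complex) set" where
  "generator_domain M X t = {f. \<exists>g. has_generator_value M X t f g}"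

definition generator ::
  "'a measure \<Rightarrow> (real \<Rightarrow> 'a \<Rightarrow> real) \<Rightarrow> real \<Rightarrow> (real \<Rightarrow> complex) \<Rightarrow> real \<Rightarrow> complex" where
  "generator M X t f = (THE g. has_generator_value M X t f g)"

lemma generator_eqI:
  assumes "has_generator_value M X t f g"
  shows "f \<in> generator_domain M X t" and "generator M X t f = g"
proof -
  show "f \<in> generator_domain M X t"
    using assms by (auto simp: generator_domain_def)
  have "g' = g" if "has_generator_value M X t f g'" for g'
  proof
    fix x
    have "((\<lambda>h. (propagator M X t (t + h) f x - f x) / complex_of_real h) \<longlongrightarrow> g' x) (at_right 0)"
      using that unfolding has_generator_value_def by (rule tendsto_uniform_limitI) simp
    moreover have "((\<lambda>h. (propagator M X t (t + h) f x - f x) / complex_of_real h) \<longlongrightarrow> g x) (at_right 0)"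
      using assms unfolding has_generator_value_def by (rule tendsto_uniform_limitI) simp
    ultimately show "g' x = g x"
      by (rule tendsto_unique[OF trivial_limit_at_right_real])
  qed
  with assms show "generator M X t f = g"
    unfolding generator_def by (rule the_equality)
qed

definition vderiv :: "nat \<Rightarrow> (real \<Rightarrow> complex) \<Rightarrow> real \<Rightarrow> complex" where
  "vderiv n = ((\<lambda>g x. vector_derivative g (at x)) ^^ n)"

definition schwartz :: "(real \<Rightarrow> complex) set" where
  "schwartz = {f. (\<forall>n x. vderiv n f differentiable (at x)) \<and>
                  (\<forall>k n. bounded (range (\<lambda>x. x ^ k *\<^sub>R vderiv n f x)))}"

definition fourier :: "(real \<Rightarrow> complex) \<Rightarrow> real \<Rightarrow> complex" where
  "fourier f p = complex_of_real (1 / sqrt (2 * pi)) * (LINT x|lborel. iexp (- (p * x)) * f x)"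

end

theory Submission
  imports Defs
begin

text \<open>
  Fourier inversion writes \<open>f\<close> as a superposition of the characters \<open>iexp (p * x)\<close>, which the
  propagator multiplies by the characteristic function of the increment; Fubini gives (i), and
  Fubini against the Levy measure gives the equality of (ii) and (iii).  For the generator, the
  difference quotient of the characteristic function tends to \<open>\<eta> p t\<close> for each \<open>p\<close>, so uniformity
  in \<open>x\<close> follows by dominated convergence once \<open>\<eta>\<close> has a bound \<open>C * (1 + p\<^sup>2)\<close> that does not depend on
  the time.  The hypothesis only bounds \<open>\<eta> p\<close> for each single \<open>p\<close>; but every Levy exponent \<open>\<psi>\<close>
  satisfies \<open>norm (\<psi> (p + q)) \<le> 2 * (norm (\<psi> p) + norm (\<psi> q))\<close>, and together with Baire's
  theorem this makes the bound uniform on an interval around \<open>0\<close> and quadratic at infinity.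
\<close>

text \<open>Domination by a tensor product of integrable functions is the form in which every use of
  Fubini below is justified: with Lebesgue measure, with the law of an increment, and with a Levy
  measure as the first factor.\<close>

lemma (in pair_sigma_finite) integrable_product_bound:
  fixes f :: "'a \<times> 'b \<Rightarrow> 'c::{banach, second_countable_topology}"
    and u :: "'a \<Rightarrow> real" and v :: "'b \<Rightarrow> real"
  assumes [measurable]: "f \<in> borel_measurable (M1 \<Otimes>\<^sub>M M2)"
    and u: "integrable M1 u" and v: "integrable M2 v"
    and bound: "\<And>x y. norm (f (x, y)) \<le> u x * v y"
  shows "integrable (M1 \<Otimes>\<^sub>M M2) f"
proof (rule Bochner_Integration.integrable_bound)
  have [measurable]: "u \<in> borel_measurable M1" "v \<in> borel_measurable M2"
    using u v by auto
  show "integrable (M1 \<Otimes>\<^sub>M M2) (\<lambda>(x, y). u x * v y)"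
    by (rule Fubini_integrable) (use u v in \<open>auto simp: abs_mult\<close>)
  show "AE x in M1 \<Otimes>\<^sub>M M2. norm (f x) \<le> norm ((\<lambda>(x, y). u x * v y) x)"
    by (rule AE_I2) (use bound in \<open>auto simp: split_beta intro!: order_trans[OF bound]\<close>)
qed auto

subsection \<open>Levy exponents\<close>

definition levy_kernel :: "real \<Rightarrow> real \<Rightarrow> complex" where
  "levy_kernel p y = iexp (p * y) - 1 - \<i> * complex_of_real (p * y * indicator {-1..1} y)"

text \<open>For \<bar>y\<bar> \<le> 1 the kernel is the first-order Taylor remainder of
  \<open>iexp\<close>, hence at most (p y)^2 / 2; for larger y the compensator vanishes and two
  terms of modulus 1 remain. The product form separates p from y, and the y-factor is what a Levy
  measure integrates.\<close>

lemma norm_levy_kernel_le: "norm (levy_kernel p y) \<le> (2 + p\<^sup>2) * min (y\<^sup>2) 1"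
proof (cases "\<bar>y\<bar> \<le> 1")
  case True
  then have "norm (levy_kernel p y) = norm (iexp (p * y) - (\<Sum>k\<le>1. (\<i> * (p * y))^k / fact k))"
    by (simp add: levy_kernel_def abs_le_iff algebra_simps)
  also have "\<dots> \<le> \<bar>p * y\<bar> ^ 2 / 2"
    using iexp_approx1[of "p * y" 1] by (simp add: numeral_2_eq_2)
  also have "\<dots> \<le> (2 + p\<^sup>2) * y\<^sup>2"
    by (simp add: power_mult_distrib algebra_simps)
  finally show ?thesis
    using True by (simp add: min_def abs_square_le_1)
next
  case False
  have "norm (levy_kernel p y) \<le> 2"
    using False norm_triangle_ineq4[of "iexp (p * y)" 1]
    by (auto simp: levy_kernel_def abs_le_iff indicator_def)
  moreover have "min (y\<^sup>2) 1 = 1"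
    using False by (simp add: min_def abs_square_le_1)
  ultimately show ?thesis
    by (simp add: add_increasing2)
qed

lemma continuous_levy_kernel: "continuous_on UNIV (\<lambda>p. levy_kernel p y)"
  unfolding levy_kernel_def by (intro continuous_intros)

text \<open>Sigma-finiteness, needed for Fubini, comes from Markov's inequality: each set where
  \<open>min (y\<^sup>2) 1\<close> is at least 1 / (n + 1) has finite measure, and these sets
  exhaust the line up to the null set {0}.\<close>

lemma
  assumes "levy_measure \<nu>"
  shows sets_levy_measure: "sets \<nu> = sets borel"
    and integrable_min_levy_measure: "integrable \<nu> (\<lambda>y. min (y\<^sup>2) 1)"
    and sigma_finite_levy_measure: "sigma_finite_measure \<nu>"
proof -
  show sets [measurable_cong]: "sets \<nu> = sets borel"
    using assms by (simp add: levy_measure_def)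
  have fin: "(\<integral>\<^sup>+ y. ennreal (min (y\<^sup>2) 1) \<partial>\<nu>) < \<infinity>"
    using assms by (simp add: levy_measure_def)
  then show int: "integrable \<nu> (\<lambda>y. min (y\<^sup>2) 1)"
    by (intro integrableI_nonneg) auto
  have space: "space \<nu> = UNIV"
    using sets_eq_imp_space_eq[OF sets] by simp
  let ?A = "\<lambda>n::nat. {y. 1 / Suc n \<le> min (y\<^sup>2) 1}"
  show "sigma_finite_measure \<nu>"
  proof
    have "emeasure \<nu> (?A n) < \<infinity>" for n
    proof -
      have "emeasure \<nu> {y \<in> space \<nu>. 1 / Suc n \<le> min (y\<^sup>2) 1} < \<infinity>"
        
        using integral_Markov_inequality[OF int, of "1 / Suc n"]
        by (auto intro: le_less_trans)
      then show ?thesis by (simp add: space)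
    qed
    moreover have "emeasure \<nu> {0} = 0"
      using assms by (simp add: levy_measure_def)
    moreover have "y \<in> (\<Union>n. ?A n)" if "y \<noteq> 0" for y
    proof -
      have "0 < min (y\<^sup>2) 1" using that by simp
      then obtain n where "inverse (real (Suc n)) < min (y\<^sup>2) 1"
        using reals_Archimedean by blast
      then show ?thesis by (intro UN_I[of n]) (auto simp: inverse_eq_divide)
    qed
    ultimately show "\<exists>A. countable A \<and> A \<subseteq> sets \<nu> \<and> \<Union> A = space \<nu> \<and> (\<forall>a\<in>A. emeasure \<nu> a \<noteq> \<infinity>)"
      by (intro exI[of _ "insert {0} (range ?A)"]) (force simp: space sets less_top[symmetric])
  qed
qed

lemma integrable_levy_kernel:
  assumes \<nu>: "levy_measure \<nu>"
  shows "integrable \<nu> (levy_kernel p)"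
proof -
  note sets_levy_measure[OF \<nu>, measurable_cong]
  show ?thesis
  proof (rule Bochner_Integration.integrable_bound)
    show "integrable \<nu> (\<lambda>y. (2 + p\<^sup>2) * min (y\<^sup>2) 1)"
      using integrable_min_levy_measure[OF \<nu>] by simp
    show "AE y in \<nu>. norm (levy_kernel p y) \<le> norm ((2 + p\<^sup>2) * min (y\<^sup>2) 1)"
      by (intro AE_I2 order_trans[OF norm_levy_kernel_le]) auto
  qed (unfold levy_kernel_def, measurable)
qed

text \<open>The linear compensators cancel in the difference of the kernel at p + q and the kernels
  at p and q, which leaves exactly this product. It is the jump part of the defect of additivity of
  a Levy exponent.\<close>

lemma integrable_levy_increment_mult:
  assumes \<nu>: "levy_measure \<nu>"
  shows "integrable \<nu> (\<lambda>y. (iexp (p * y) - 1) * (iexp (q * y) - 1))"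
proof -
  have "(\<lambda>y. (iexp (p * y) - 1) * (iexp (q * y) - 1)) =
      (\<lambda>y. levy_kernel (p + q) y - levy_kernel p y - levy_kernel q y)"
    by (auto simp: levy_kernel_def fun_eq_iff algebra_simps simp flip: exp_add)
  then show ?thesis
    using integrable_levy_kernel[OF \<nu>] by simp
qed

definition levy_exponent :: "real \<Rightarrow> real \<Rightarrow> real measure \<Rightarrow> real \<Rightarrow> complex" where
  "levy_exponent b z \<nu> p = \<i> * complex_of_real (b * p) - complex_of_real (1/2 * z * p\<^sup>2)
     + (LINT y|\<nu>. levy_kernel p y)"

lemma continuous_levy_exponent:
  assumes \<nu>: "levy_measure \<nu>"
  shows "continuous_on UNIV (levy_exponent b z \<nu>)"
proof -
  note [measurable_cong] = sets_levy_measure[OF \<nu>]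
  have "continuous_on UNIV (\<lambda>p. LINT y|\<nu>. levy_kernel p y)"
  proof (clarsimp simp: continuous_on_sequentially comp_def)
    fix P :: "nat \<Rightarrow> real" and p assume P: "P \<longlonglongrightarrow> p"
    \<comment> \<open>A convergent sequence is bounded, so the p-dependent factor of the kernel
      bound is at most 2 + K^2 and one majorant serves all n.\<close>
    obtain K where K: "\<And>n. \<bar>P n\<bar> \<le> K"
      using convergent_imp_Bseq[of P] P by (auto simp: convergent_def Bseq_def)
    show "(\<lambda>n. LINT y|\<nu>. levy_kernel (P n) y) \<longlonglongrightarrow> (LINT y|\<nu>. levy_kernel p y)"
    proof (rule integral_dominated_convergence)
      show "integrable \<nu> (\<lambda>y. (2 + K\<^sup>2) * min (y\<^sup>2) 1)"
        using integrable_min_levy_measure[OF \<nu>] by simp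
      show "AE y in \<nu>. (\<lambda>n. levy_kernel (P n) y) \<longlonglongrightarrow> levy_kernel p y"
        using P continuous_levy_kernel by (auto simp: continuous_on_sequentially comp_def)
      show "AE y in \<nu>. norm (levy_kernel (P n) y) \<le> (2 + K\<^sup>2) * min (y\<^sup>2) 1" for n
        using abs_le_square_iff[of "P n" K] K[of n]
        by (intro AE_I2 order_trans[OF norm_levy_kernel_le] mult_right_mono) auto
    qed (use integrable_levy_kernel[OF \<nu>] in auto)
  qed
  then show ?thesis
    unfolding levy_exponent_def by (intro continuous_intros)
qed

text \<open>Since \<bar>e^{ipy} - 1\<bar>^2 = 2 - 2 cos(py), the real part of the kernel is minus
  half this square. Thus \<open>- Re\<close> of the exponent controls both the Gaussian coefficient
  and the L2 size of the jump increments.\<close>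

lemma Re_levy_exponent:
  assumes \<nu>: "levy_measure \<nu>"
  shows "Re (levy_exponent b z \<nu> p) =
    - (z * p\<^sup>2 / 2) - (LINT y|\<nu>. (norm (iexp (p * y) - 1))\<^sup>2) / 2"
proof -
  have "Re (LINT y|\<nu>. levy_kernel p y) = (LINT y|\<nu>. Re (levy_kernel p y))"
    using integrable_levy_kernel[OF \<nu>] by simp
  also have "\<dots> = (LINT y|\<nu>. - ((norm (iexp (p * y) - 1))\<^sup>2 / 2))"
  proof (rule Bochner_Integration.integral_cong)
    fix y
    have "(norm (iexp (p * y) - 1))\<^sup>2 = 2 - 2 * cos (p * y)"
      using sin_cos_squared_add[of "p * y"]
      by (simp only: cmod_power2 cis_conv_exp[symmetric]) (simp add: power2_eq_square algebra_simps)
    then show "Re (levy_kernel p y) = - ((norm (iexp (p * y) - 1))\<^sup>2 / 2)"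
      by (simp only: levy_kernel_def cis_conv_exp[symmetric]) (simp add: field_simps)
  qed simp
  finally show ?thesis
    by (simp add: levy_exponent_def)
qed

lemma levy_exponent_minus:
  assumes "levy_measure \<nu>"
  shows "levy_exponent b z \<nu> (- p) = cnj (levy_exponent b z \<nu> p)"
proof -
  have "levy_kernel (- p) y = cnj (levy_kernel p y)" for y
    by (simp add: levy_kernel_def exp_cnj)
  then show ?thesis
    by (simp add: levy_exponent_def)
qed

text \<open>The defect of additivity consists of the cross terms -zpq and the integral of the
  product of the increments. By the inequality \<bar>ac\<bar> \<le> a^2/2 + c^2/2, their norms add
  up to at most \<open>- Re (?\<psi> p) - Re (?\<psi> q)\<close>, which is at most the sum of the
  two norms.\<close>

lemma norm_levy_exponent_add_le:
  assumes \<nu>: "levy_measure \<nu>" and z: "0 \<le> z"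
  shows "norm (levy_exponent b z \<nu> (p + q)) \<le>
    2 * (norm (levy_exponent b z \<nu> p) + norm (levy_exponent b z \<nu> q))"
proof -
  let ?\<psi> = "levy_exponent b z \<nu>"
  let ?e = "\<lambda>p y. iexp (p * y) - 1"
  \<comment> \<open>The diagonal case q = p of the product, in absolute value.\<close>
  have int2: "integrable \<nu> (\<lambda>y. (norm (?e p y))\<^sup>2)" for p
    using integrable_norm[OF integrable_levy_increment_mult[OF \<nu>, of p p]]
    by (simp add: norm_mult power2_eq_square)
  have "(LINT y|\<nu>. ?e p y * ?e q y) =
      (LINT y|\<nu>. levy_kernel (p + q) y - levy_kernel p y - levy_kernel q y)"
    by (rule Bochner_Integration.integral_cong)
       (auto simp: levy_kernel_def algebra_simps simp flip: exp_add)
  also have "\<dots> = (LINT y|\<nu>. levy_kernel (p + q) y) - (LINT y|\<nu>. levy_kernel p y) - (LINT y|\<nu>. levy_kernel q y)"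
    using integrable_levy_kernel[OF \<nu>] by simp
  finally have eq: "?\<psi> (p + q) = ?\<psi> p + ?\<psi> q - complex_of_real (z * p * q) + (LINT y|\<nu>. ?e p y * ?e q y)"
    by (simp add: levy_exponent_def algebra_simps power2_eq_square)
  have ag: "\<bar>a * c\<bar> \<le> a\<^sup>2 / 2 + c\<^sup>2 / 2" for a c :: real
    using zero_le_power2[of "\<bar>a\<bar> - \<bar>c\<bar>"] by (simp add: power2_diff abs_mult)
  have "norm (LINT y|\<nu>. ?e p y * ?e q y) \<le> (LINT y|\<nu>. norm (?e p y * ?e q y))"
    by (rule integral_norm_bound)
  also have "\<dots> \<le> (LINT y|\<nu>. (norm (?e p y))\<^sup>2 / 2 + (norm (?e q y))\<^sup>2 / 2)"
  proof (rule integral_mono)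
    show "norm (?e p y * ?e q y) \<le> (norm (?e p y))\<^sup>2 / 2 + (norm (?e q y))\<^sup>2 / 2" for y
      using ag[of "norm (?e p y)" "norm (?e q y)"] by (simp add: norm_mult abs_mult)
  qed (use int2 integrable_levy_increment_mult[OF \<nu>] in auto)
  also have "\<dots> = (LINT y|\<nu>. (norm (?e p y))\<^sup>2) / 2 + (LINT y|\<nu>. (norm (?e q y))\<^sup>2) / 2"
    using int2 by simp
  finally have 1: "norm (LINT y|\<nu>. ?e p y * ?e q y) \<le>
      (LINT y|\<nu>. (norm (?e p y))\<^sup>2) / 2 + (LINT y|\<nu>. (norm (?e q y))\<^sup>2) / 2" .
  have "norm (complex_of_real (z * p * q)) = z * \<bar>p * q\<bar>"
    using z by (simp only: norm_of_real) (simp add: abs_mult)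
  also have "\<dots> \<le> z * (p\<^sup>2 / 2 + q\<^sup>2 / 2)"
    using z ag by (intro mult_left_mono)
  finally have 2: "norm (complex_of_real (z * p * q)) \<le> z * p\<^sup>2 / 2 + z * q\<^sup>2 / 2"
    by (simp add: algebra_simps)
  have "norm (?\<psi> (p + q)) \<le> norm (?\<psi> p) + norm (?\<psi> q) + (- Re (?\<psi> p) - Re (?\<psi> q))"
    unfolding eq using 1 2 norm_triangle_ineq[of "?\<psi> p" "?\<psi> q"]
      norm_triangle_ineq4[of "?\<psi> p + ?\<psi> q" "complex_of_real (z * p * q)"]
      norm_triangle_ineq[of "?\<psi> p + ?\<psi> q - complex_of_real (z * p * q)" "LINT y|\<nu>. ?e p y * ?e q y"]
    by (simp only: Re_levy_exponent[OF \<nu>])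
  moreover have "- Re w \<le> norm w" for w
    using abs_Re_le_cmod[of w] by linarith
  ultimately show ?thesis
    by (smt (verit))
qed

subsection \<open>Uniform quadratic bounds\<close>

text \<open>The common sublevel sets \<open>A n\<close> are closed and, by pointwise boundedness,
  cover the space. If none contained a ball, their complements would be open and dense, and Baire's
  theorem would give a point outside all of them.\<close>

lemma Baire_family_bounded_on_ball:
  fixes G :: "('a::{real_normed_vector, heine_borel} \<Rightarrow> real) set"
  assumes cont: "\<And>g. g \<in> G \<Longrightarrow> continuous_on UNIV g"
    and bdd: "\<And>x. \<exists>B. \<forall>g\<in>G. g x \<le> B"
  shows "\<exists>c \<delta> B. 0 < \<delta> \<and> (\<forall>g\<in>G. \<forall>x\<in>ball c \<delta>. g x \<le> B)"
proof (rule ccontr)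
  assume contr: "\<not> ?thesis"
  define A where "A n = {x. \<forall>g\<in>G. g x \<le> real n}" for n :: nat
  have "A n = (\<Inter>g\<in>G. {x. g x \<le> real n})" for n
    by (auto simp: A_def)
  then have closed: "closed (A n)" for n
    using cont by (auto intro!: closed_Collect_le continuous_on_const)
  have dense: "closure (- A n) = UNIV" for n
  proof -
    have "interior (A n) = {}"
    proof (rule ccontr)
      assume "interior (A n) \<noteq> {}"
      then obtain c where "c \<in> interior (A n)"
        by blast
      then obtain \<delta> where "0 < \<delta>" "ball c \<delta> \<subseteq> A n"
        by (auto simp: mem_interior)
      then have "\<forall>g\<in>G. \<forall>x\<in>ball c \<delta>. g x \<le> real n"
        by (auto simp: A_def)
      with \<open>0 < \<delta>\<close> contr show False by blast
    qed
    then show ?thesis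
      by (simp add: closure_complement)
  qed
  have "UNIV \<subseteq> closure (\<Inter>(range (\<lambda>n. - A n)))"
  proof (rule Baire)
    fix T assume "T \<in> range (\<lambda>n. - A n)"
    then show "openin (top_of_set UNIV) T \<and> UNIV \<subseteq> closure T"
      using closed dense by auto
  qed auto
  then have "\<Inter>(range (\<lambda>n. - A n)) \<noteq> {}"
    by (metis UNIV_not_empty closure_empty subset_empty)
  then obtain x where x: "\<And>n. x \<notin> A n"
    by auto
  obtain B where "\<forall>g\<in>G. g x \<le> B"
    using bdd by blast
  moreover obtain n where "B \<le> real n"
    using real_arch_simple by blast
  ultimately have "x \<in> A n"
    by (force simp: A_def)
  with x show False by blast
qed

text \<open>
  The doubling estimate \<open>g (2 * p) \<le> 4 * g p\<close> spreads a bound near the origin, supplied by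
  Baire's theorem and quasi-subadditivity, to the whole line.
\<close>
lemma quasi_subadditive_family_quadratic_bound:
  fixes G :: "(real \<Rightarrow> real) set"
  assumes cont: "\<And>g. g \<in> G \<Longrightarrow> continuous_on UNIV g"
    and bdd: "\<And>p. \<exists>B. \<forall>g\<in>G. g p \<le> B"
    and nonneg: "\<And>g p. g \<in> G \<Longrightarrow> 0 \<le> g p"
    and even: "\<And>g p. g \<in> G \<Longrightarrow> g (- p) = g p"
    and add: "\<And>g p q. g \<in> G \<Longrightarrow> g (p + q) \<le> 2 * (g p + g q)"
  shows "\<exists>C\<ge>0. \<forall>g\<in>G. \<forall>p. g p \<le> C * (1 + p\<^sup>2)"
proof -
  obtain c \<delta> B where \<delta>: "0 < \<delta>" and B: "\<And>g x. g \<in> G \<Longrightarrow> x \<in> ball c \<delta> \<Longrightarrow> g x \<le> B"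
    using Baire_family_bounded_on_ball[OF cont bdd] by blast
  \<comment> \<open>Writing p = (c + p) + (-c) moves the bound from the ball around c to one around
    0: two values of size B, doubled by quasi-subadditivity, give 4 B. The maximum with 0 makes N
    usable as a nonnegative factor.\<close>
  define N where "N = max 0 (4 * B)"
  have N: "0 \<le> N" by (simp add: N_def)
  have near: "g p \<le> N" if "g \<in> G" "\<bar>p\<bar> < \<delta>" for g p
  proof -
    have "g p \<le> 2 * (g (c + p) + g c)"
      using add[of g "c + p" "- c"] even[of g c] that by simp
    also have "\<dots> \<le> 2 * (B + B)"
      using that \<delta> B[of g "c + p"] B[of g c] by (simp add: dist_real_def)
    finally show ?thesis by (simp add: N_def)
  qed
  \<comment> \<open>Induction over dyadic scales: halving p costs a factor 4, which the square
    absorbs exactly. The descent stops between \<delta>/2 and \<delta>, where 4 p^2 / \<delta>^2 is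
    at least 1 and the bound N near the origin suffices.\<close>
  have far: "g p \<le> N * (4 * p\<^sup>2 / \<delta>\<^sup>2)" if "g \<in> G" "\<delta> / 2 \<le> \<bar>p\<bar>" "\<bar>p\<bar> < 2 ^ k * \<delta>" for g p and k :: nat
    using that(2,3)
  proof (induction k arbitrary: p)
    case 0
    have "(\<delta> / 2)\<^sup>2 \<le> p\<^sup>2"
      using 0 \<delta> by (simp add: abs_le_square_iff[symmetric])
    then have "1 \<le> 4 * p\<^sup>2 / \<delta>\<^sup>2"
      using \<delta> by (simp add: field_simps)
    then have "N * 1 \<le> N * (4 * p\<^sup>2 / \<delta>\<^sup>2)"
      by (rule mult_left_mono) (rule N)
    then show ?case
      using near[OF \<open>g \<in> G\<close>, of p] 0 by simp
  next
    case (Suc k)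
    show ?case
    proof (cases "\<delta> \<le> \<bar>p\<bar>")
      case True
      then have "g (p / 2) \<le> N * (4 * (p / 2)\<^sup>2 / \<delta>\<^sup>2)"
        using Suc.prems by (intro Suc.IH) auto
      moreover have "g p \<le> 4 * g (p / 2)"
        using add[OF \<open>g \<in> G\<close>, of "p / 2" "p / 2"] by simp
      ultimately have "g p \<le> 4 * (N * (4 * (p / 2)\<^sup>2 / \<delta>\<^sup>2))"
        by linarith
      then show ?thesis
        by (simp add: power_divide mult_ac)
    next
      case False
      have "(\<delta> / 2)\<^sup>2 \<le> p\<^sup>2"
        using Suc.prems \<delta> by (simp add: abs_le_square_iff[symmetric])
      then have "1 \<le> 4 * p\<^sup>2 / \<delta>\<^sup>2"
        using \<delta> by (simp add: field_simps)
      then have "N * 1 \<le> N * (4 * p\<^sup>2 / \<delta>\<^sup>2)"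
        by (rule mult_left_mono) (rule N)
      then show ?thesis
        using near[OF \<open>g \<in> G\<close>, of p] False by simp
    qed
  qed
  show ?thesis
  \<comment> \<open>This constant dominates the sum of the near and the far bound, with the
    nonnegative surplus N p^2 + 4 N / \<delta>^2.\<close>
  proof (intro exI[of _ "N * (1 + 4 / \<delta>\<^sup>2)"] conjI ballI allI)
    show "0 \<le> N * (1 + 4 / \<delta>\<^sup>2)" using N by simp
    fix g p assume g: "g \<in> G"
    have "g p \<le> N + N * (4 * p\<^sup>2 / \<delta>\<^sup>2)"
    proof (cases "\<bar>p\<bar> < \<delta>")
      case True
      then show ?thesis using near[OF g True] N by (simp add: add_increasing2)
    next
      case False
      obtain k :: nat where "\<bar>p\<bar> / \<delta> < 2 ^ k"
        using real_arch_pow[of 2 "\<bar>p\<bar> / \<delta>"] by auto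
      then have "\<bar>p\<bar> < 2 ^ k * \<delta>"
        using \<delta> by (simp add: field_simps)
      then have "g p \<le> N * (4 * p\<^sup>2 / \<delta>\<^sup>2)"
        using False \<delta> by (intro far[OF g]) auto
      then show ?thesis using N by simp
    qed
    also have "\<dots> \<le> N * (1 + 4 / \<delta>\<^sup>2) * (1 + p\<^sup>2)"
    proof -
      have "N * (1 + 4 / \<delta>\<^sup>2) * (1 + p\<^sup>2) = N + N * (4 * p\<^sup>2 / \<delta>\<^sup>2) + (N * p\<^sup>2 + N * (4 / \<delta>\<^sup>2))"
        by (simp add: algebra_simps add_divide_distrib)
      then show ?thesis using N by simp
    qed
    finally show "g p \<le> (N * (1 + 4 / \<delta>\<^sup>2)) * (1 + p\<^sup>2)" .
  qed
qed

subsection \<open>Fourier inversion for Schwartz functions\<close>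

lemma vderiv_0 [simp]: "vderiv 0 f = f"
  by (simp add: vderiv_def)

lemma vderiv_vderiv: "vderiv m (vderiv n f) = vderiv (m + n) f"
  by (simp add: vderiv_def funpow_add)

lemma vderiv_in_schwartz: "f \<in> schwartz \<Longrightarrow> vderiv n f \<in> schwartz"
  by (auto simp: schwartz_def vderiv_vderiv)

lemma schwartz_has_vector_derivative:
  assumes "f \<in> schwartz"
  shows "(f has_vector_derivative vderiv 1 f x) (at x)"
proof -
  have "vderiv 0 f differentiable (at x)"
    using assms unfolding schwartz_def by blast
  then show ?thesis
    by (simp add: vector_derivative_works[symmetric] vderiv_def)
qed

lemma isCont_schwartz: "f \<in> schwartz \<Longrightarrow> isCont f x"
  using schwartz_has_vector_derivative by (rule has_vector_derivative_continuous)

lemma borel_measurable_schwartz [measurable]: "f \<in> schwartz \<Longrightarrow> f \<in> borel_measurable borel"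
  by (intro borel_measurable_continuous_onI continuous_at_imp_continuous_on ballI isCont_schwartz)

text \<open>Adding the bounds for k = 0 and k = 2 gives a majorant that is both integrable and
  vanishing at infinity; the first yields integrability, the second kills boundary terms.\<close>

lemma schwartz_bound:
  assumes f: "f \<in> schwartz"
  obtains C where "0 \<le> C" "\<And>x. norm (f x) \<le> C * inverse (1 + x\<^sup>2)"
proof -
  have bdd: "bounded (range (\<lambda>x. x ^ k *\<^sub>R vderiv 0 f x))" for k
    using f unfolding schwartz_def by blast
  obtain B0 B2 where B: "\<And>x. norm (f x) \<le> B0" "\<And>x. norm (x\<^sup>2 *\<^sub>R f x) \<le> B2"
    using bdd[of 0] bdd[of 2] by (auto simp: bounded_iff)
  have "norm (f x) \<le> (B0 + B2) * inverse (1 + x\<^sup>2)" for x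
  proof -
    have "norm (f x) * (1 + x\<^sup>2) \<le> B0 + B2"
      using B[of x] by (simp add: algebra_simps)
    moreover have "0 < 1 + x\<^sup>2"
      by (simp add: add_pos_nonneg)
    ultimately show ?thesis
      by (simp add: field_simps)
  qed
  moreover have "0 \<le> B0 + B2"
    using order_trans[OF norm_ge_zero B(1)[of 0]] order_trans[OF norm_ge_zero B(2)[of 0]] by simp
  ultimately show thesis
    using that by blast
qed

lemma integrable_inverse_1_plus_square_lborel: "integrable lborel (\<lambda>x::real. inverse (1 + x\<^sup>2))"
  using integrable_inverse_1_plus_square by (simp add: set_integrable_def)

lemma integrable_schwartz:
  assumes f: "f \<in> schwartz"
  shows "integrable lborel f"
proof -
  obtain C where C: "0 \<le> C" "\<And>x. norm (f x) \<le> C * inverse (1 + x\<^sup>2)"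
    using schwartz_bound[OF f] by blast
  show ?thesis
  proof (rule Bochner_Integration.integrable_bound)
    show "integrable lborel (\<lambda>x. C * inverse (1 + x\<^sup>2))"
      using integrable_inverse_1_plus_square_lborel by simp
    show "AE x in lborel. norm (f x) \<le> norm (C * inverse (1 + x\<^sup>2))"
      by (intro AE_I2 order_trans[OF C(2)]) auto
  qed (use f in measurable)
qed

lemma schwartz_tendsto_0:
  assumes f: "f \<in> schwartz"
  shows "(f \<longlongrightarrow> 0) at_top" "(f \<longlongrightarrow> 0) at_bot"
proof -
  obtain C where C: "0 \<le> C" "\<And>x. norm (f x) \<le> C * inverse (1 + x\<^sup>2)"
    using schwartz_bound[OF f] by blast
  have "((\<lambda>x. C * inverse (1 + x\<^sup>2)) \<longlongrightarrow> 0) at_top" "((\<lambda>x. C * inverse (1 + x\<^sup>2)) \<longlongrightarrow> 0) at_bot"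
    by real_asymp+
  then show "(f \<longlongrightarrow> 0) at_top" "(f \<longlongrightarrow> 0) at_bot"
    by (auto intro: Lim_null_comparison[rotated] simp: C(2))
qed

section \<open>Fourier transform of Schwartz functions: derivatives and decay\<close>

lemma norm_iexp [simp]: "norm (iexp x) = 1"
  using norm_exp_i_times[of x] by simp

lemma integrable_iexp_mult [simp]:
  assumes "integrable lborel f"
  shows "integrable lborel (\<lambda>x. iexp (c * x) * f x)"
  by (rule Bochner_Integration.integrable_bound[OF assms]) (use assms in \<open>auto simp: norm_mult\<close>)

text \<open>Integration by parts: \<open>F'\<close> is the derivative of the integrand
  \<open>F\<close>, and its integral over the line vanishes because \<open>F\<close> has modulus
  \<bar>f\<bar> and so tends to 0 at both ends.\<close>

lemma fourier_vderiv_1: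
  assumes f: "f \<in> schwartz"
  shows "fourier (vderiv 1 f) p = \<i> * complex_of_real p * fourier f p"
proof -
  define F where "F x = iexp (- (p * x)) * f x" for x
  define F' where "F' x = iexp (- (p * x)) * vderiv 1 f x - \<i> * p * (iexp (- (p * x)) * f x)" for x
  note f' = vderiv_in_schwartz[OF f, of 1]
  have int: "integrable lborel (\<lambda>x. iexp (- (p * x)) * g x)" if "g \<in> schwartz" for g
    using integrable_iexp_mult[OF integrable_schwartz[OF that], of "- p"] by simp
  have F: "(F has_vector_derivative F' x) (at x)" for x
  proof -
    have "((\<lambda>x. iexp (- (p * x))) has_vector_derivative - \<i> * p * iexp (- (p * x))) (at x)"
      using has_vector_derivative_real_field[where f = "\<lambda>z. exp (\<i> * (- (complex_of_real p * z)))"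
          and f' = "- \<i> * p * iexp (- (p * x))" and a = x and s = UNIV]
      by (force intro!: derivative_eq_intros)
    from has_vector_derivative_mult[OF this schwartz_has_vector_derivative[OF f, of x]]
    show ?thesis
      unfolding F_def[abs_def] F'_def by (simp add: algebra_simps)
  qed
  have F'_int: "integrable lborel F'"
    unfolding F'_def using int[OF f] int[OF f'] by simp
  have lim: "(F \<longlongrightarrow> 0) at_top" "(F \<longlongrightarrow> 0) at_bot"
    using schwartz_tendsto_0[OF f, THEN tendsto_norm_zero]
    by (auto intro!: tendsto_norm_zero_cancel[of F] simp: F_def norm_mult)
  have "(LBINT x=-\<infinity>..\<infinity>. F' x) = 0 - 0"
  proof (rule interval_integral_FTC_integrable[where F = F])
    show "set_integrable lborel (einterval (-\<infinity>) \<infinity>) F'"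
      using F'_int by (simp add: set_integrable_def)
    show "isCont F' x" for x
      unfolding F'_def by (intro continuous_intros isCont_schwartz f f')
    show "((F \<circ> real_of_ereal) \<longlongrightarrow> 0) (at_right (-\<infinity>))"
      using lim(2) by (simp add: at_right_MInf filterlim_filtermap comp_def tendsto_compose_filtermap)
    show "((F \<circ> real_of_ereal) \<longlongrightarrow> 0) (at_left \<infinity>)"
      using lim(1) by (simp add: at_left_PInf filterlim_filtermap comp_def tendsto_compose_filtermap)
  qed (use F in auto)
  then have "(LINT x|lborel. F' x) = 0"
    by (simp add: interval_lebesgue_integral_def set_lebesgue_integral_def)
  then have "(LINT x|lborel. iexp (- (p * x)) * vderiv 1 f x) = \<i> * p * (LINT x|lborel. iexp (- (p * x)) * f x)"
    unfolding F'_def using int[OF f] int[OF f'] by simp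
  then show ?thesis
    by (simp add: fourier_def)
qed

lemma fourier_vderiv:
  assumes f: "f \<in> schwartz"
  shows "fourier (vderiv n f) p = (\<i> * complex_of_real p) ^ n * fourier f p"
proof (induction n)
  case (Suc n)
  have "vderiv (Suc n) f = vderiv 1 (vderiv n f)"
    by (simp add: vderiv_vderiv)
  then show ?case
    using fourier_vderiv_1[OF vderiv_in_schwartz[OF f, of n], of p] Suc by simp
qed simp

lemma norm_inverse_sqrt_2pi_le_1: "norm (complex_of_real (1 / sqrt (2 * pi))) \<le> 1"
proof -
  have "1 \<le> sqrt (2 * pi)" using pi_ge_two by simp
  then show ?thesis by (simp only: norm_of_real) (simp add: field_simps)
qed

lemma norm_fourier_le: "norm (fourier f p) \<le> (LINT x|lborel. norm (f x))"
proof -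
  have "norm (LINT x|lborel. iexp (- (p * x)) * f x) \<le> (LINT x|lborel. norm (f x))"
    using integral_norm_bound[of lborel "\<lambda>x. iexp (- (p * x)) * f x"] 
    by (simp add: norm_mult del: of_real_minus of_real_mult)
  then show ?thesis
    unfolding fourier_def norm_mult using norm_inverse_sqrt_2pi_le_1
    by (meson mult_left_le_one_le norm_ge_zero order_trans)
qed

lemma borel_measurable_fourier [measurable]:
  assumes [measurable]: "f \<in> borel_measurable borel"
  shows "fourier f \<in> borel_measurable borel"
  unfolding fourier_def[abs_def] by measurable

text \<open>Expanding (1 + p^2)^2 = 1 + 2 p^2 + p^4, each power of p is traded for a derivative of
  order 0, 2 or 4, whose L1 norm bounds its transform. One factor 1 + p^2 pays for the growth of the
  exponent, the other leaves something integrable.\<close>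

lemma fourier_schwartz_bound:
  assumes f: "f \<in> schwartz"
  obtains C where "0 \<le> C" "\<And>p. (1 + p\<^sup>2) * norm (fourier f p) \<le> C * inverse (1 + p\<^sup>2)"
proof -
  let ?C = "\<lambda>n. LINT x|lborel. norm (vderiv n f x)"
  have 1: "\<bar>p\<bar> ^ n * norm (fourier f p) \<le> ?C n" for n p
    using norm_fourier_le[of "vderiv n f" p] by (simp add: fourier_vderiv[OF f] norm_mult norm_power)
  have "(1 + p\<^sup>2) * norm (fourier f p) \<le> (?C 0 + 2 * ?C 2 + ?C 4) * inverse (1 + p\<^sup>2)" for p
  proof -
    have "(1 + p\<^sup>2)\<^sup>2 * norm (fourier f p) =
        norm (fourier f p) + 2 * (p\<^sup>2 * norm (fourier f p)) + p ^ 4 * norm (fourier f p)"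
      by (simp add: power2_eq_square power4_eq_xxxx algebra_simps)
    also have "\<dots> \<le> ?C 0 + 2 * ?C 2 + ?C 4"
      using 1[of p 0] 1[of p 2] 1[of p 4] by simp
    finally have "(1 + p\<^sup>2) * norm (fourier f p) * (1 + p\<^sup>2) \<le> ?C 0 + 2 * ?C 2 + ?C 4"
      by (simp add: power2_eq_square mult_ac)
    moreover have "0 < 1 + p\<^sup>2"
      by (simp add: add_pos_nonneg)
    ultimately show ?thesis
      by (simp add: field_simps)
  qed
  moreover have "0 \<le> ?C 0 + 2 * ?C 2 + ?C 4"
    by (simp add: integral_nonneg)
  ultimately show thesis
    using that by blast
qed

lemma integrable_fourier_schwartz_weighted:
  assumes f: "f \<in> schwartz"
  shows "integrable lborel (\<lambda>p. (1 + p\<^sup>2) * norm (fourier f p))"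
proof -
  obtain C where C: "0 \<le> C" "\<And>p. (1 + p\<^sup>2) * norm (fourier f p) \<le> C * inverse (1 + p\<^sup>2)"
    using fourier_schwartz_bound[OF f] by blast
  note [measurable] = borel_measurable_schwartz[OF f]
  show ?thesis
  proof (rule Bochner_Integration.integrable_bound)
    show "integrable lborel (\<lambda>x. C * inverse (1 + x\<^sup>2))"
      using integrable_inverse_1_plus_square_lborel by simp
    show "AE p in lborel. norm ((1 + p\<^sup>2) * norm (fourier f p)) \<le> norm (C * inverse (1 + p\<^sup>2))"
      using C by (intro AE_I2) (auto simp: abs_mult add_nonneg_nonneg)
  qed measurable
qed

text \<open>The class of multipliers is chosen to contain characteristic functions, Levy exponents
  with a quadratic bound, and the errors of the difference quotients.\<close>

lemma integrable_mult_fourier_schwartz: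
  assumes f: "f \<in> schwartz" and [measurable]: "g \<in> borel_measurable borel"
    and g: "\<And>p. norm (g p) \<le> C * (1 + p\<^sup>2)"
  shows "integrable lborel (\<lambda>p. g p * fourier f p)"
proof (rule Bochner_Integration.integrable_bound)
  note [measurable] = borel_measurable_schwartz[OF f]
  show "integrable lborel (\<lambda>p. C * ((1 + p\<^sup>2) * norm (fourier f p)))"
    using integrable_fourier_schwartz_weighted[OF f] by simp
  show "(\<lambda>p. g p * fourier f p) \<in> borel_measurable lborel" by measurable
  have "norm (g p * fourier f p) \<le> C * ((1 + p\<^sup>2) * norm (fourier f p))" for p
    using mult_right_mono[OF g[of p] norm_ge_zero[of "fourier f p"]] by (simp add: norm_mult mult_ac)
  then show "AE p in lborel. norm (g p * fourier f p) \<le> norm (C * ((1 + p\<^sup>2) * norm (fourier f p)))"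
    by (intro AE_I2) (simp only: real_norm_def, meson abs_ge_self order_trans)
qed

lemma integrable_fourier_schwartz: "f \<in> schwartz \<Longrightarrow> integrable lborel (fourier f)"
  using integrable_mult_fourier_schwartz[of f "\<lambda>_. 1" 1] by simp

section \<open>Gaussian regularisation and Fourier inversion\<close>

lemma LINT_gaussian_iexp:
  "(LINT p|lborel. iexp (p * u) * complex_of_real (std_normal_density p)) = complex_of_real (exp (- u\<^sup>2 / 2))"
proof -
  have "char std_normal_distribution u = (LINT p|lborel. std_normal_density p *\<^sub>R iexp (u * p))"
    unfolding char_def by (subst integral_density) auto
  then show ?thesis
    by (simp add: char_std_normal_distribution scaleR_conv_of_real mult.commute)
qed

text \<open>
  With a Gaussian factor of width \<open>1/\<epsilon>\<close> inserted, Fubini turns the inversion integral into the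
  convolution of \<open>f\<close> with a Gaussian of width \<open>\<epsilon>\<close>.
\<close>
lemma gaussian_fourier_inversion:
  assumes f: "f \<in> schwartz" and \<epsilon>: "0 < \<epsilon>"
  shows "complex_of_real (1 / sqrt (2 * pi)) *
      (LINT p|lborel. iexp (p * x) * complex_of_real (exp (- (\<epsilon> * p)\<^sup>2 / 2)) * fourier f p) =
    (LINT u|lborel. complex_of_real (std_normal_density u) * f (x + \<epsilon> * u))"
proof -
  note [measurable] = borel_measurable_schwartz[OF f]
  let ?c = "complex_of_real (1 / sqrt (2 * pi))"
  \<comment> \<open>One normalising constant stems from the inversion integral, the other from the
    transform inside it.\<close>
  have cc: "?c * ?c = complex_of_real (1 / (2 * pi))"
    by (simp flip: of_real_mult)
  define k where "k p y = iexp (p * (x - y)) * complex_of_real (exp (- (\<epsilon> * p)\<^sup>2 / 2)) * f y" for p y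
  have gauss: "integrable lborel (\<lambda>p. exp (- (\<epsilon> * p)\<^sup>2 / 2))"
  proof -
    have "integrable lborel (\<lambda>p. sqrt (2 * pi) * std_normal_density (0 + \<epsilon> * p))"
      using integrable_normal_density[of 1 0] lborel_integrable_real_affine[of std_normal_density \<epsilon> 0] \<epsilon> by simp
    then show ?thesis by (simp add: std_normal_density_def)
  qed
  have int: "integrable (lborel \<Otimes>\<^sub>M lborel) (case_prod k)"
  proof (rule lborel_pair.integrable_product_bound)
    show "norm (case_prod k (p, y)) \<le> exp (- (\<epsilon> * p)\<^sup>2 / 2) * norm (f y)" for p y
      unfolding k_def prod.case norm_mult norm_iexp norm_of_real by simp
    show "case_prod k \<in> borel_measurable (lborel \<Otimes>\<^sub>M lborel)"
      unfolding k_def by measurable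
  qed (use gauss integrable_schwartz[OF f] in auto)
  have "?c * (LINT p|lborel. iexp (p * x) * complex_of_real (exp (- (\<epsilon> * p)\<^sup>2 / 2)) * fourier f p)
      = ?c * (LINT p|lborel. ?c * (LINT y|lborel. k p y))"
  proof (intro arg_cong[where f = "(*) ?c"] Bochner_Integration.integral_cong refl)
    fix p
    have "iexp (p * x) * complex_of_real (exp (- (\<epsilon> * p)\<^sup>2 / 2)) * fourier f p
      = ?c * (LINT y|lborel. (iexp (p * x) * complex_of_real (exp (- (\<epsilon> * p)\<^sup>2 / 2))) * (iexp (- (p * y)) * f y))"
      unfolding fourier_def by (subst integral_mult_right_zero) (simp only: mult_ac)
    also have "(LINT y|lborel. (iexp (p * x) * complex_of_real (exp (- (\<epsilon> * p)\<^sup>2 / 2))) * (iexp (- (p * y)) * f y))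
       = (LINT y|lborel. k p y)"
    proof (intro Bochner_Integration.integral_cong refl)
      fix y
      have "iexp (p * (x - y)) = iexp (p * x) * iexp (- (p * y))"
        by (simp add: algebra_simps flip: exp_add)
      then show "(iexp (p * x) * complex_of_real (exp (- (\<epsilon> * p)\<^sup>2 / 2))) * (iexp (- (p * y)) * f y) = k p y"
        unfolding k_def by (simp only: mult_ac)
    qed
    finally show "iexp (p * x) * complex_of_real (exp (- (\<epsilon> * p)\<^sup>2 / 2)) * fourier f p = ?c * (LINT y|lborel. k p y)" .
  qed
  also have "\<dots> = complex_of_real (1 / (2 * pi)) * (LINT p|lborel. LINT y|lborel. k p y)"
    using cc by (simp only: integral_mult_right_zero mult.assoc[symmetric])
  also have "(LINT p|lborel. LINT y|lborel. k p y) = (LINT y|lborel. LINT p|lborel. k p y)"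
    using lborel_pair.Fubini_integral[OF int] by simp
  also have "\<dots> = (LINT y|lborel. complex_of_real (sqrt (2 * pi) / \<epsilon> * exp (- ((x - y) / \<epsilon>)\<^sup>2 / 2)) * f y)"
  proof (intro Bochner_Integration.integral_cong refl)
    fix y
    \<comment> \<open>Replacing p by p / \<epsilon> turns the Gaussian factor into a multiple of the
      standard normal density, whose characteristic function is then evaluated at (x - y) /
      \<epsilon>.\<close>
    have "(LINT p|lborel. iexp (p * (x - y)) * complex_of_real (exp (- (\<epsilon> * p)\<^sup>2 / 2))) =
      \<bar>1 / \<epsilon>\<bar> *\<^sub>R (LINT p|lborel. iexp ((0 + 1 / \<epsilon> * p) * (x - y)) * complex_of_real (exp (- (\<epsilon> * (0 + 1 / \<epsilon> * p))\<^sup>2 / 2)))"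
      using \<epsilon> by (intro lborel_integral_real_affine) auto
    also have "\<dots> = (1 / \<epsilon>) *\<^sub>R (LINT p|lborel. complex_of_real (sqrt (2 * pi)) * (iexp (p * ((x - y) / \<epsilon>)) * complex_of_real (std_normal_density p)))"
      using \<epsilon> by (simp add: std_normal_density_def)
    also have "\<dots> = complex_of_real (sqrt (2 * pi) / \<epsilon> * exp (- ((x - y) / \<epsilon>)\<^sup>2 / 2))"
      unfolding integral_mult_right_zero LINT_gaussian_iexp by (simp add: scaleR_conv_of_real)
    finally show "(LINT p|lborel. k p y) = complex_of_real (sqrt (2 * pi) / \<epsilon> * exp (- ((x - y) / \<epsilon>)\<^sup>2 / 2)) * f y"
      unfolding k_def integral_mult_left_zero by simp
  qed
  \<comment> \<open>Substitution y = x + \<epsilon> u; the argument (x - y) / \<epsilon> becomes -u,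
    whose sign disappears in the square.\<close>
  also have "\<dots> = \<bar>\<epsilon>\<bar> *\<^sub>R (LINT u|lborel. complex_of_real (sqrt (2 * pi) / \<epsilon> * exp (- ((x - (x + \<epsilon> * u)) / \<epsilon>)\<^sup>2 / 2)) * f (x + \<epsilon> * u))"
    using \<epsilon> by (intro lborel_integral_real_affine) auto
  also have "\<dots> = (LINT u|lborel. complex_of_real (2 * pi) * (complex_of_real (std_normal_density u) * f (x + \<epsilon> * u)))"
  proof -
    \<comment> \<open>Splits off the normalisation of the standard density; the remaining factor 2
      pi cancels the outer constant 1 / (2 pi).\<close>
    have "sqrt (2 * pi) = 2 * pi * (1 / sqrt (2 * pi))"
      by (simp add: real_div_sqrt)
    then have "complex_of_real \<epsilon> * (complex_of_real (sqrt (2 * pi) / \<epsilon> * exp (- ((x - (x + \<epsilon> * u)) / \<epsilon>)\<^sup>2 / 2)) * v)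
      = complex_of_real (2 * pi) * (complex_of_real (std_normal_density u) * v)" for u v
      using \<epsilon> unfolding std_normal_density_def mult.assoc[symmetric] of_real_mult[symmetric]
      by (simp add: field_simps flip: of_real_mult)
    then show ?thesis
      using \<epsilon> by (simp only: scaleR_conv_of_real integral_mult_right_zero[symmetric] abs_of_pos)
  qed
  also have "complex_of_real (1 / (2 * pi)) * \<dots> = (LINT u|lborel. complex_of_real (std_normal_density u) * f (x + \<epsilon> * u))"
    unfolding integral_mult_right_zero by simp
  finally show ?thesis .
qed

text \<open>The two sides are limits of the same regularised sequence as \<epsilon> tends to 0. The
  convolution tends to f x since f is bounded and continuous; in the frequency integral the Gaussian
  factor tends to 1 and stays below it, so the integrable transform dominates.\<close>

theorem fourier_inversion_schwartz:
  assumes f: "f \<in> schwartz"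
  shows "f x = complex_of_real (1 / sqrt (2 * pi)) * (LINT p|lborel. iexp (p * x) * fourier f p)"
proof (rule LIMSEQ_unique)
  note [measurable] = borel_measurable_schwartz[OF f]
  define \<epsilon> where "\<epsilon> n = 1 / real (Suc n)" for n
  have \<epsilon>: "0 < \<epsilon> n" for n by (simp add: \<epsilon>_def)
  have lim: "\<epsilon> \<longlonglongrightarrow> 0"
    unfolding \<epsilon>_def by real_asymp
  obtain C where C: "0 \<le> C" "\<And>x. norm (f x) \<le> C * inverse (1 + x\<^sup>2)"
    using schwartz_bound[OF f] by blast
  have C': "norm (f x) \<le> C" for x
  proof -
    have "inverse (1 + x\<^sup>2) \<le> 1" by (intro inverse_le_1_iff[THEN iffD2]) simp
    then have "C * inverse (1 + x\<^sup>2) \<le> C * 1" by (rule mult_left_mono) (rule C)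
    then show ?thesis using C(2)[of x] by simp
  qed
  have "(\<lambda>n. LINT u|lborel. complex_of_real (std_normal_density u) * f (x + \<epsilon> n * u)) \<longlonglongrightarrow>
      (LINT u|lborel. complex_of_real (std_normal_density u) * f x)"
  proof (rule integral_dominated_convergence)
    show "integrable lborel (\<lambda>u. std_normal_density u * C)"
      using integrable_normal_density[of 1 0] by simp
    have "(\<lambda>n. f (x + \<epsilon> n * u)) \<longlonglongrightarrow> f x" for u
      by (rule isCont_tendsto_compose[OF isCont_schwartz[OF f]]) (auto intro!: tendsto_eq_intros lim)
    then show "AE u in lborel. (\<lambda>n. complex_of_real (std_normal_density u) * f (x + \<epsilon> n * u)) \<longlonglongrightarrow>
        complex_of_real (std_normal_density u) * f x"
      by (intro AE_I2 tendsto_intros)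
    show "AE u in lborel. norm (complex_of_real (std_normal_density u) * f (x + \<epsilon> n * u)) \<le> std_normal_density u * C" for n
      unfolding norm_mult norm_of_real using C' by (intro AE_I2 mult_mono) auto
  qed measurable
  moreover have "(LINT u|lborel. complex_of_real (std_normal_density u) * f x) = f x"
    using integral_normal_density[of 1 0] unfolding integral_mult_left_zero integral_of_real by simp
  ultimately show "(\<lambda>n. LINT u|lborel. complex_of_real (std_normal_density u) * f (x + \<epsilon> n * u)) \<longlonglongrightarrow> f x"
    by simp
  have "(\<lambda>n. LINT p|lborel. iexp (p * x) * complex_of_real (exp (- (\<epsilon> n * p)\<^sup>2 / 2)) * fourier f p) \<longlonglongrightarrow>
      (LINT p|lborel. iexp (p * x) * fourier f p)"
  proof (rule integral_dominated_convergence)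
    show "integrable lborel (\<lambda>p. norm (fourier f p))"
      using integrable_fourier_schwartz[OF f] by simp
    have "(\<lambda>n. iexp (p * x) * complex_of_real (exp (- (\<epsilon> n * p)\<^sup>2 / 2)) * fourier f p) \<longlonglongrightarrow>
        iexp (p * x) * complex_of_real (exp (- (0 * p)\<^sup>2 / 2)) * fourier f p" for p
      by (intro tendsto_intros lim) simp
    then show "AE p in lborel. (\<lambda>n. iexp (p * x) * complex_of_real (exp (- (\<epsilon> n * p)\<^sup>2 / 2)) * fourier f p) \<longlonglongrightarrow>
        iexp (p * x) * fourier f p"
      by simp
    show "AE p in lborel. norm (iexp (p * x) * complex_of_real (exp (- (\<epsilon> n * p)\<^sup>2 / 2)) * fourier f p) \<le> norm (fourier f p)" for n
      unfolding norm_mult norm_of_real norm_iexp by (intro AE_I2 mult_left_le_one_le) auto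
  qed measurable
  then show "(\<lambda>n. LINT u|lborel. complex_of_real (std_normal_density u) * f (x + \<epsilon> n * u)) \<longlonglongrightarrow>
      complex_of_real (1 / sqrt (2 * pi)) * (LINT p|lborel. iexp (p * x) * fourier f p)"
    unfolding gaussian_fourier_inversion[OF f \<epsilon>, symmetric] by (intro tendsto_intros)
qed

subsection \<open>Propagator and generator\<close>

text \<open>After inversion of f and exchange of the integrals, averaging the character over the law
  produces its characteristic function. Stated for an arbitrary law, this serves both the propagator
  formula and the short increments in the generator.\<close>

lemma (in real_distribution) propagate_schwartz:
  assumes f: "f \<in> schwartz"
  shows "integrable lborel (\<lambda>p. iexp (p * x) * char M p * fourier f p)" (is ?int)
    and "(LINT y|M. f (x + y)) = complex_of_real (1 / sqrt (2 * pi)) *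
      (LINT p|lborel. iexp (p * x) * char M p * fourier f p)" (is ?eq)
proof -
  interpret P: pair_sigma_finite M lborel ..
  note [measurable] = borel_measurable_schwartz[OF f] borel_measurable_continuous_onI[OF continuous_at_imp_continuous_on[OF ballI[OF isCont_char]]]
  have "(\<lambda>p. iexp (p * x) * char M p) \<in> borel_measurable borel"
    by measurable
  moreover have "norm (iexp (p * x) * char M p) \<le> 1 * (1 + p\<^sup>2)" for p
    using cmod_char_le_1[of p] unfolding norm_mult norm_iexp by (simp add: add_increasing2)
  ultimately show ?int
    by (rule integrable_mult_fourier_schwartz[OF f])
  define k where "k y p = iexp (p * (x + y)) * fourier f p" for y p
  have int: "integrable (M \<Otimes>\<^sub>M lborel) (case_prod k)"
  proof (rule P.integrable_product_bound)
    show "norm (case_prod k (y, p)) \<le> 1 * norm (fourier f p)" for y p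
      unfolding k_def prod.case norm_mult norm_iexp by simp
    show "case_prod k \<in> borel_measurable (M \<Otimes>\<^sub>M lborel)"
      unfolding k_def by measurable
  qed (use integrable_fourier_schwartz[OF f] in auto)
  have "(LINT y|M. f (x + y)) = (LINT y|M. complex_of_real (1 / sqrt (2 * pi)) * (LINT p|lborel. k y p))"
    unfolding k_def by (subst fourier_inversion_schwartz[OF f]) simp
  also have "\<dots> = complex_of_real (1 / sqrt (2 * pi)) * (LINT y|M. LINT p|lborel. k y p)"
    by (rule integral_mult_right_zero)
  also have "(LINT y|M. LINT p|lborel. k y p) = (LINT p|lborel. LINT y|M. k y p)"
    using P.Fubini_integral[OF int] by simp
  also have "\<dots> = (LINT p|lborel. iexp (p * x) * char M p * fourier f p)"
  proof (intro Bochner_Integration.integral_cong refl)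
    fix p
    have "k y p = iexp (p * x) * (iexp (p * y) * fourier f p)" for y
      by (simp add: k_def algebra_simps exp_add)
    then show "(LINT y|M. k y p) = iexp (p * x) * char M p * fourier f p"
      by (simp add: char_def)
  qed
  finally show ?eq .
qed

text \<open>On the character e^{ipx} the integro-differential operator acts as multiplication by the
  exponent: derivatives give powers of ip, and the compensated jump difference gives
  \<open>levy_kernel p y\<close>. Inversion and Fubini superpose these identities.\<close>

lemma levy_operator_schwartz:
  assumes f: "f \<in> schwartz" and \<nu>: "levy_measure \<nu>"
  shows "integrable \<nu> (\<lambda>y. f (x + y) - f x - complex_of_real (y * indicator {-1..1} y) * vderiv 1 f x)" (is ?int1)
    and "integrable lborel (\<lambda>p. iexp (p * x) * levy_exponent b z \<nu> p * fourier f p)" (is ?int2)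
    and "complex_of_real (1/2 * z) * vderiv 2 f x + complex_of_real b * vderiv 1 f x
        + (LINT y|\<nu>. f (x + y) - f x - complex_of_real (y * indicator {-1..1} y) * vderiv 1 f x) =
      complex_of_real (1 / sqrt (2 * pi)) *
        (LINT p|lborel. iexp (p * x) * levy_exponent b z \<nu> p * fourier f p)" (is ?eq)
proof -
  interpret \<nu>: sigma_finite_measure \<nu>
    using \<nu> by (rule sigma_finite_levy_measure)
  interpret P: pair_sigma_finite \<nu> lborel ..
  note [measurable_cong] = sets_levy_measure[OF \<nu>]
  note [measurable] = borel_measurable_schwartz[OF f]
  let ?c = "complex_of_real (1 / sqrt (2 * pi))"
  let ?d = "\<lambda>y. f (x + y) - f x - complex_of_real (y * indicator {-1..1} y) * vderiv 1 f x"
  define k where "k y p = iexp (p * x) * levy_kernel p y * fourier f p" for y p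
  \<comment> \<open>The weight of the kernel bound, split as 1 + (1 + p^2).\<close>
  have w: "integrable lborel (\<lambda>p. (2 + p\<^sup>2) * norm (fourier f p))"
  proof -
    have "integrable lborel (\<lambda>p. norm (fourier f p) + (1 + p\<^sup>2) * norm (fourier f p))"
      using integrable_fourier_schwartz_weighted[OF f] integrable_fourier_schwartz[OF f] by simp
    then show ?thesis by (simp add: algebra_simps)
  qed
  have int: "integrable (\<nu> \<Otimes>\<^sub>M lborel) (case_prod k)"
  proof (rule P.integrable_product_bound)
    show "norm (case_prod k (y, p)) \<le> min (y\<^sup>2) 1 * ((2 + p\<^sup>2) * norm (fourier f p))" for y p
      using mult_right_mono[OF norm_levy_kernel_le[of p y] norm_ge_zero[of "fourier f p"]]
      unfolding k_def prod.case norm_mult norm_iexp by (simp add: mult_ac)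
    show "case_prod k \<in> borel_measurable (\<nu> \<Otimes>\<^sub>M lborel)"
      unfolding k_def levy_kernel_def by measurable
  qed (use integrable_min_levy_measure[OF \<nu>] w in auto)
  have inv: "g u = ?c * (LINT p|lborel. iexp (p * u) * fourier g p)"
      "integrable lborel (\<lambda>p. iexp (p * u) * fourier g p)" if "g \<in> schwartz" for g u
    using fourier_inversion_schwartz[OF that] integrable_iexp_mult[OF integrable_fourier_schwartz[OF that], of u]
    by (simp_all add: mult.commute[of u])
  note f1 = vderiv_in_schwartz[OF f, of 1] and f2 = vderiv_in_schwartz[OF f, of 2]
  \<comment> \<open>The factor ip of the compensator is absorbed into the transform of the
    derivative, so that three inversions rebuild the jump difference. Its integrability in y then
    follows from joint integrability of \<open>k\<close>.\<close>
  have d: "?d y = ?c * (LINT p|lborel. k y p)" for y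
  proof -
    let ?e = "complex_of_real (y * indicator {-1..1} y)"
    have "k y p = iexp (p * (x + y)) * fourier f p - iexp (p * x) * fourier f p
        - ?e * (iexp (p * x) * fourier (vderiv 1 f) p)" for p
      unfolding k_def levy_kernel_def fourier_vderiv[OF f]
      by (simp add: algebra_simps exp_add)
    then have "(LINT p|lborel. k y p) = (LINT p|lborel. iexp (p * (x + y)) * fourier f p)
        - (LINT p|lborel. iexp (p * x) * fourier f p) - ?e * (LINT p|lborel. iexp (p * x) * fourier (vderiv 1 f) p)"
      using inv(2)[OF f, of x] inv(2)[OF f, of "x + y"] inv(2)[OF f1, of x]
      by (simp del: of_real_mult of_real_add)
    then show ?thesis
      unfolding inv(1)[OF f, of x] inv(1)[OF f, of "x + y"] inv(1)[OF f1, of x]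
      by (simp only: right_diff_distrib mult.left_commute)
  qed
  have "integrable \<nu> (\<lambda>y. ?c * (LINT p|lborel. k y p))"
    using P.integrable_fst'[OF int] by simp
  then show ?int1
    unfolding d .
  have dec: "iexp (p * x) * levy_exponent b z \<nu> p * fourier f p =
      complex_of_real b * (iexp (p * x) * fourier (vderiv 1 f) p)
      + complex_of_real (1/2 * z) * (iexp (p * x) * fourier (vderiv 2 f) p) + (LINT y|\<nu>. k y p)" for p
  proof -
    have "(LINT y|\<nu>. k y p) = iexp (p * x) * (LINT y|\<nu>. levy_kernel p y) * fourier f p"
      by (simp add: k_def)
    then show ?thesis
      unfolding levy_exponent_def fourier_vderiv[OF f]
      by (simp add: power2_eq_square algebra_simps)
  qed
  have k2: "integrable lborel (\<lambda>p. LINT y|\<nu>. k y p)"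
    using P.integrable_snd[OF int] by simp
  show ?int2
    unfolding dec using inv(2)[OF f1, of x] inv(2)[OF f2, of x] k2
    by (simp del: of_real_mult)
  have "(LINT p|lborel. iexp (p * x) * levy_exponent b z \<nu> p * fourier f p) =
      complex_of_real b * (LINT p|lborel. iexp (p * x) * fourier (vderiv 1 f) p)
      + complex_of_real (1/2 * z) * (LINT p|lborel. iexp (p * x) * fourier (vderiv 2 f) p)
      + (LINT p|lborel. LINT y|\<nu>. k y p)"
    unfolding dec using inv(2)[OF f1, of x] inv(2)[OF f2, of x] k2
    by (simp del: of_real_mult)
  also have "(LINT p|lborel. LINT y|\<nu>. k y p) = (LINT y|\<nu>. LINT p|lborel. k y p)"
    by (rule P.Fubini_integral[OF int])
  finally have "?c * (LINT p|lborel. iexp (p * x) * levy_exponent b z \<nu> p * fourier f p) =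
      complex_of_real b * vderiv 1 f x + complex_of_real (1/2 * z) * vderiv 2 f x
      + ?c * (LINT y|\<nu>. LINT p|lborel. k y p)"
    unfolding inv(1)[OF f1, of x] inv(1)[OF f2, of x] by (simp only: distrib_left mult.left_commute)
  moreover have "(LINT y|\<nu>. ?d y) = ?c * (LINT y|\<nu>. LINT p|lborel. k y p)"
    unfolding d by (rule integral_mult_right_zero)
  ultimately show ?eq
    by simp
qed

text \<open>Mean value estimate between 0 and w in the closed left half plane, which is convex and
  on which the derivative of \<open>exp\<close> has modulus at most 1.\<close>

lemma norm_exp_minus_1_le:
  fixes w :: complex
  assumes "Re w \<le> 0"
  shows "norm (exp w - 1) \<le> norm w"
proof -
  have "norm (exp w - exp 0) \<le> 1 * norm (w - 0)"
  proof (rule field_differentiable_bound[where S = "{w. Re w \<le> 0}" and f' = exp])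
    show "(exp has_field_derivative exp u) (at u within {w. Re w \<le> 0})" for u :: complex
      by (intro DERIV_exp[THEN has_field_derivative_at_within])
  qed (use assms in \<open>auto simp: convex_halfspace_Re_le\<close>)
  then show ?thesis by simp
qed

text \<open>The quotient is a one-sided difference quotient at t. The integral vanishes at h = 0,
  where \<open>exp\<close> has derivative 1, so the fundamental theorem and the chain rule give g
  t.\<close>

lemma tendsto_exp_integral_quotient:
  fixes g :: "real \<Rightarrow> complex"
  assumes g: "continuous_on {t..} g"
  shows "((\<lambda>h. (exp (integral {t..t + h} g) - 1) / complex_of_real h) \<longlongrightarrow> g t) (at_right 0)"
proof -
  have "((\<lambda>u. integral {t..u} g) has_vector_derivative g t) (at t within {t..t + 1})"
    by (rule integral_has_vector_derivative) (auto intro: continuous_on_subset[OF g])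
  from field_vector_diff_chain_within[OF this, of exp "exp 0"]
  have "((\<lambda>u. exp (integral {t..u} g)) has_vector_derivative g t) (at t within {t..t + 1})"
    by (simp add: comp_def DERIV_exp[of 0, simplified, THEN has_field_derivative_at_within])
  then have "((\<lambda>u. (1 / norm (u - t)) *\<^sub>R (exp (integral {t..u} g) - (1 + (u - t) *\<^sub>R g t))) \<longlongrightarrow> 0) (at t within {t..t + 1})"
    by (simp add: has_vector_derivative_def has_derivative_within)
  then have "((\<lambda>h. (1 / norm h) *\<^sub>R (exp (integral {t..t + h} g) - (1 + h *\<^sub>R g t))) \<longlongrightarrow> 0) (at_right 0)"
    by (simp add: at_within_Icc_at_right filterlim_at_right_to_0[of _ _ t] add.commute)
  \<comment> \<open>For h > 0 the norm of h is h itself, so the normalised remainder is the quotient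
    minus its claimed limit.\<close>
  moreover have "\<forall>\<^sub>F h in at_right 0. (1 / norm h) *\<^sub>R (exp (integral {t..t + h} g) - (1 + h *\<^sub>R g t))
      = (exp (integral {t..t + h} g) - 1) / complex_of_real h - g t"
    unfolding eventually_at_right_field
    by (intro exI[of _ 1]) (auto simp: scaleR_conv_of_real field_simps)
  ultimately have "((\<lambda>h. (exp (integral {t..t + h} g) - 1) / complex_of_real h - g t) \<longlongrightarrow> 0) (at_right 0)"
    by (rule Lim_transform_eventually)
  then show ?thesis
    by (rule LIM_zero_cancel)
qed

context additive_process
begin

lemma real_distribution_increment_law:
  assumes "0 \<le> s" "s \<le> t"
  shows "real_distribution (increment_law M X s t)"
proof -
  have [measurable]: "X s \<in> borel_measurable M" "X t \<in> borel_measurable M"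
    using assms rv by auto
  show ?thesis
    unfolding increment_law_def by (rule real_distribution_distr) measurable
qed

lemma char_increment_law:
  assumes "0 \<le> s" "s \<le> t"
  shows "char (increment_law M X s t) p = (LINT \<omega>|M. iexp (p * (X t \<omega> - X s \<omega>)))"
proof -
  have [measurable]: "X s \<in> borel_measurable M" "X t \<in> borel_measurable M"
    using assms rv by auto
  show ?thesis
    unfolding increment_law_def char_def by (subst integral_distr) auto
qed

text \<open>In the error of the difference quotient, x occurs only in the factor
  \<open>iexp (p * x)\<close> of modulus 1. Hence the L1 norm \<open>J h\<close> of the remaining
  integrand bounds the error uniformly in x, and pointwise convergence in p with a quadratic bound
  suffices.\<close>

lemma has_generator_value_fourier:
  fixes \<eta> :: "real \<Rightarrow> real \<Rightarrow> complex"
  assumes char: "\<And>s t p. 0 \<le> s \<Longrightarrow> s \<le> t \<Longrightarrow>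
      char (increment_law M X s t) p = exp (LINT \<tau>:{s..t}|lborel. \<eta> p \<tau>)"
    and cont: "\<And>p. continuous_on {0..} (\<eta> p)"
    and bound: "\<And>p \<tau>. 0 \<le> \<tau> \<Longrightarrow> norm (\<eta> p \<tau>) \<le> C * (1 + p\<^sup>2)"
    and meas [measurable]: "(\<lambda>p. \<eta> p t) \<in> borel_measurable borel"
    and t: "0 \<le> t" and f: "f \<in> schwartz"
  shows "has_generator_value M X t f
    (\<lambda>x. complex_of_real (1 / sqrt (2 * pi)) * (LINT p|lborel. iexp (p * x) * \<eta> p t * fourier f p))"
proof -
  let ?c = "complex_of_real (1 / sqrt (2 * pi))"
  note [measurable] = borel_measurable_schwartz[OF f]
  define \<phi> where "\<phi> h = char (increment_law M X t (t + h))" for h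
  define D where "D h p = (\<phi> h p - 1) / complex_of_real h - \<eta> p t" for h p
  have \<phi>_meas [measurable]: "\<phi> h \<in> borel_measurable borel" if "0 < h" for h
  proof -
    interpret \<mu>: real_distribution "increment_law M X t (t + h)"
      using t that by (intro real_distribution_increment_law) auto
    show ?thesis
      unfolding \<phi>_def using \<mu>.isCont_char by (intro borel_measurable_continuous_onI continuous_at_imp_continuous_on) auto
  qed
  have D_meas [measurable]: "D h \<in> borel_measurable borel" if "0 < h" for h
  proof -
    note [measurable] = \<phi>_meas[OF that]
    show ?thesis unfolding D_def[abs_def] by measurable
  qed
  have sub: "continuous_on {t..} (\<eta> p)" for p
    using cont by (rule continuous_on_subset) (use t in auto)
  \<comment> \<open>Passage from the Lebesgue integral to the gauge integral, for which the
    derivative and the length bound are applied below.\<close>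
  have \<phi>_eq: "\<phi> h p = exp (integral {t..t + h} (\<eta> p))" if "0 < h" for h p
  proof -
    have "set_integrable lborel {t..t + h} (\<eta> p)"
      using sub by (intro borel_integrable_atLeastAtMost' continuous_on_subset[OF sub]) auto
    then show ?thesis
      using t that by (simp add: \<phi>_def char set_borel_integral_eq_integral)
  qed
  have D_lim: "((\<lambda>h. D h p) \<longlongrightarrow> 0) (at_right 0)" for p
  proof (rule Lim_transform_eventually)
    show "((\<lambda>h. (exp (integral {t..t + h} (\<eta> p)) - 1) / complex_of_real h - \<eta> p t) \<longlongrightarrow> 0) (at_right 0)"
      using tendsto_exp_integral_quotient[OF sub] by (rule LIM_zero)
    show "\<forall>\<^sub>F h in at_right 0. (exp (integral {t..t + h} (\<eta> p)) - 1) / complex_of_real h - \<eta> p t = D h p"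
      by (auto simp: D_def \<phi>_eq eventually_at_right_field intro!: exI[of _ 1])
  qed
  have D_bound: "norm (D h p) \<le> 2 * C * (1 + p\<^sup>2)" if "0 < h" for h p
  proof -
    interpret \<mu>: real_distribution "increment_law M X t (t + h)"
      using t that by (intro real_distribution_increment_law) auto
    let ?W = "integral {t..t + h} (\<eta> p)"
    \<comment> \<open>A characteristic function has modulus at most 1, so \<open>?W\<close> lies in
      the left half plane. There \<bar>exp W - 1\<bar> \<le> \<bar>W\<bar>, and the length h of the
      interval cancels the division by h.\<close>
    have "exp (Re ?W) \<le> 1"
      using \<mu>.cmod_char_le_1[of p] \<phi>_eq[OF that, of p] by (simp add: \<phi>_def norm_exp_eq_Re)
    then have "norm (\<phi> h p - 1) \<le> norm ?W"
      unfolding \<phi>_eq[OF that] by (intro norm_exp_minus_1_le) simp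
    also have "\<dots> \<le> (C * (1 + p\<^sup>2)) * (t + h - t)"
      using that t by (intro integral_bound continuous_on_subset[OF sub] bound) auto
    finally have "norm ((\<phi> h p - 1) / complex_of_real h) \<le> C * (1 + p\<^sup>2)"
      using that by (simp add: norm_divide divide_simps)
    then show ?thesis
      unfolding D_def using bound[OF t, of p] norm_triangle_ineq4[of "(\<phi> h p - 1) / complex_of_real h" "\<eta> p t"]
      by linarith
  qed
  define J where "J h = (LINT p|lborel. norm (D h p * fourier f p))" for h
  have int_D: "integrable lborel (\<lambda>p. iexp (p * x) * D h p * fourier f p)" if "0 < h" for h x
  proof -
    note [measurable] = D_meas[OF that]
    show ?thesis
    proof (rule integrable_mult_fourier_schwartz[OF f])
      show "norm (iexp (p * x) * D h p) \<le> 2 * C * (1 + p\<^sup>2)" for p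
        using D_bound[OF that, of p] unfolding norm_mult norm_iexp by simp
    qed measurable
  qed
  have "(J \<longlongrightarrow> 0) (at_right 0)"
  \<comment> \<open>Dominated convergence works along sequences, hence the reduction.\<close>
  proof (rule tendsto_at_right_sequentially[of 0 1])
    fix S :: "nat \<Rightarrow> real" assume S: "\<And>n. 0 < S n" "S \<longlonglongrightarrow> 0"
    note [measurable] = D_meas[OF S(1)]
    have "filterlim S (at_right 0) sequentially"
      using S by (intro tendsto_imp_filterlim_at_right) auto
    then have lim: "(\<lambda>n. D (S n) p) \<longlonglongrightarrow> 0" for p
      by (rule filterlim_compose[OF D_lim])
    have "(\<lambda>n. J (S n)) \<longlonglongrightarrow> (LINT p|lborel. norm (0 * fourier f p))"
      unfolding J_def
    proof (rule integral_dominated_convergence)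
      show "integrable lborel (\<lambda>p. 2 * C * ((1 + p\<^sup>2) * norm (fourier f p)))"
        using integrable_fourier_schwartz_weighted[OF f] by simp
      show "AE p in lborel. (\<lambda>n. norm (D (S n) p * fourier f p)) \<longlonglongrightarrow> norm (0 * fourier f p)"
        by (intro AE_I2 tendsto_intros lim)
      show "AE p in lborel. norm (norm (D (S n) p * fourier f p)) \<le> 2 * C * ((1 + p\<^sup>2) * norm (fourier f p))" for n
      proof (rule AE_I2)
        fix p
        show "norm (norm (D (S n) p * fourier f p)) \<le> 2 * C * ((1 + p\<^sup>2) * norm (fourier f p))"
          using mult_right_mono[OF D_bound[OF S(1), of n p] norm_ge_zero[of "fourier f p"]]
          by (simp add: norm_mult mult_ac)
      qed
    qed measurable
    then show "(\<lambda>n. J (S n)) \<longlonglongrightarrow> 0" by simp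
  qed simp
  have le_J: "norm ((propagator M X t (t + h) f x - f x) / complex_of_real h
      - ?c * (LINT p|lborel. iexp (p * x) * \<eta> p t * fourier f p)) \<le> J h" if h: "0 < h" for h x
  proof -
    interpret \<mu>: real_distribution "increment_law M X t (t + h)"
      using t that by (intro real_distribution_increment_law) auto
    have int\<eta>: "integrable lborel (\<lambda>p. iexp (p * x) * \<eta> p t * fourier f p)"
    proof (rule integrable_mult_fourier_schwartz[OF f])
      show "norm (iexp (p * x) * \<eta> p t) \<le> C * (1 + p\<^sup>2)" for p
        using bound[OF t, of p] unfolding norm_mult norm_iexp by simp
    qed measurable
    have int0: "integrable lborel (\<lambda>p. iexp (p * x) * fourier f p)"
      using integrable_iexp_mult[OF integrable_fourier_schwartz[OF f], of x] by (simp add: mult.commute[of x])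
    have int\<phi>: "integrable lborel (\<lambda>p. iexp (p * x) * \<phi> h p * fourier f p)"
      unfolding \<phi>_def by (rule \<mu>.propagate_schwartz(1)[OF f])
    have "(propagator M X t (t + h) f x - f x) / complex_of_real h
        - ?c * (LINT p|lborel. iexp (p * x) * \<eta> p t * fourier f p)
      = (?c * (LINT p|lborel. iexp (p * x) * \<phi> h p * fourier f p) - ?c * (LINT p|lborel. iexp (p * x) * fourier f p)) / complex_of_real h
        - ?c * (LINT p|lborel. iexp (p * x) * \<eta> p t * fourier f p)"
      unfolding propagator_def \<mu>.propagate_schwartz(2)[OF f] \<phi>_def fourier_inversion_schwartz[OF f, of x] ..
    also have "\<dots> = ?c * (((LINT p|lborel. iexp (p * x) * \<phi> h p * fourier f p) - (LINT p|lborel. iexp (p * x) * fourier f p)) / complex_of_real h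
        - (LINT p|lborel. iexp (p * x) * \<eta> p t * fourier f p))"
      by (simp only: right_diff_distrib times_divide_eq_right diff_divide_distrib)
    also have "\<dots> = ?c * (LINT p|lborel. (iexp (p * x) * \<phi> h p * fourier f p - iexp (p * x) * fourier f p) / complex_of_real h
        - iexp (p * x) * \<eta> p t * fourier f p)"
      using int\<eta> int0 int\<phi> by (simp del: of_real_mult)
    also have "\<dots> = ?c * (LINT p|lborel. iexp (p * x) * D h p * fourier f p)"
      unfolding D_def by (intro arg_cong[where f = "(*) ?c"] Bochner_Integration.integral_cong refl)
        (simp add: algebra_simps diff_divide_distrib del: of_real_mult)
    finally have eq: "(propagator M X t (t + h) f x - f x) / complex_of_real h
        - ?c * (LINT p|lborel. iexp (p * x) * \<eta> p t * fourier f p)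
        = ?c * (LINT p|lborel. iexp (p * x) * D h p * fourier f p)" .
    have "norm (LINT p|lborel. iexp (p * x) * D h p * fourier f p) \<le> J h"
      using integral_norm_bound[of lborel "\<lambda>p. iexp (p * x) * D h p * fourier f p"]
      by (simp add: J_def norm_mult del: of_real_mult)
    then show ?thesis
      unfolding eq norm_mult using norm_inverse_sqrt_2pi_le_1
      by (meson mult_left_le_one_le norm_ge_zero order_trans)
  qed
  show ?thesis
    unfolding has_generator_value_def
  proof (rule uniform_limitI)
    fix e :: real assume "0 < e"
    then have "\<forall>\<^sub>F h in at_right 0. J h < e"
      by (rule order_tendstoD(2)[OF \<open>(J \<longlongrightarrow> 0) (at_right 0)\<close>])
    moreover have "\<forall>\<^sub>F h in at_right 0. (0::real) < h"
      by (rule eventually_at_right_less)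
    ultimately show "\<forall>\<^sub>F h in at_right 0. \<forall>x\<in>UNIV.
        dist ((propagator M X t (t + h) f x - f x) / complex_of_real h)
          (?c * (LINT p|lborel. iexp (p * x) * \<eta> p t * fourier f p)) < e"
    proof eventually_elim
      case (elim h)
      then show ?case
        unfolding dist_norm by (blast intro: le_less_trans[OF le_J])
    qed
  qed
qed

end

theorem lemma1:
  fixes M :: "'a measure" and X :: "real \<Rightarrow> 'a \<Rightarrow> real"
    and \<eta> :: "real \<Rightarrow> real \<Rightarrow> complex"
    and b z :: "real \<Rightarrow> real" and \<nu> :: "real \<Rightarrow> real measure"
    and f :: "real \<Rightarrow> complex"
  assumes X: "additive_process M X"
    and char_increments: "\<And>s t p. 0 \<le> s \<Longrightarrow> s \<le> t \<Longrightarrow>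
      (LINT \<omega>|M. iexp (p * (X t \<omega> - X s \<omega>))) = exp (LINT \<tau>:{s..t}|lborel. \<eta> p \<tau>)"
    and z: "\<And>t. 0 \<le> t \<Longrightarrow> 0 \<le> z t"
    and \<nu>: "\<And>t. 0 \<le> t \<Longrightarrow> levy_measure (\<nu> t)"
    and \<eta>: "\<And>p t. 0 \<le> t \<Longrightarrow>
      \<eta> p t = \<i> * complex_of_real (b t * p) - complex_of_real (1/2 * z t * p\<^sup>2)
        + (LINT y|\<nu> t. iexp (p * y) - 1 - \<i> * complex_of_real (p * y * indicator {-1..1} y))"
    and continuous: "\<And>p. continuous_on {0..} (\<eta> p)"
    and bounded: "\<And>p. bounded (\<eta> p ` {0..})"
    and f: "f \<in> schwartz"
  shows "(\<forall>s t x. 0 \<le> s \<and> s \<le> t \<longrightarrow>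
            integrable lborel
              (\<lambda>p. iexp (p * x) * exp (LINT \<tau>:{s..t}|lborel. \<eta> p \<tau>) * fourier f p) \<and>
            propagator M X s t f x = complex_of_real (1 / sqrt (2 * pi)) *
              (LINT p|lborel. iexp (p * x) * exp (LINT \<tau>:{s..t}|lborel. \<eta> p \<tau>) * fourier f p)) \<and>
         (\<forall>t\<ge>0. f \<in> generator_domain M X t \<and>
           (\<forall>x. integrable lborel (\<lambda>p. iexp (p * x) * \<eta> p t * fourier f p) \<and>
                generator M X t f x = complex_of_real (1 / sqrt (2 * pi)) *
                  (LINT p|lborel. iexp (p * x) * \<eta> p t * fourier f p))) \<and>
         (\<forall>t\<ge>0. \<forall>x.
            integrable (\<nu> t)
              (\<lambda>y. f (x + y) - f x - complex_of_real (y * indicator {-1..1} y) * vderiv 1 f x) \<and>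
            generator M X t f x =
              complex_of_real (1/2 * z t) * vderiv 2 f x + complex_of_real (b t) * vderiv 1 f x
              + (LINT y|\<nu> t. f (x + y) - f x
                   - complex_of_real (y * indicator {-1..1} y) * vderiv 1 f x))"
proof -
  interpret additive_process M X by (rule X)
  have \<eta>_eq: "\<eta> p t = levy_exponent (b t) (z t) (\<nu> t) p" if "0 \<le> t" for p t
    using \<eta>[OF that, of p] by (simp only: levy_exponent_def levy_kernel_def)
  have char: "char (increment_law M X s t) p = exp (LINT \<tau>:{s..t}|lborel. \<eta> p \<tau>)"
    if "0 \<le> s" "s \<le> t" for s t p
    using char_increments[OF that] char_increment_law[OF that] by simp
  \<comment> \<open>The family is indexed by time, its members being functions of p. Evenness is the
    conjugate symmetry of the exponent, and pointwise boundedness is the assumed bound in t for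
    fixed p.\<close>
  have "\<exists>C\<ge>0. \<forall>g\<in>(\<lambda>t p. norm (\<eta> p t)) ` {0..}. \<forall>p. g p \<le> C * (1 + p\<^sup>2)"
  proof (rule quasi_subadditive_family_quadratic_bound)
    show "\<exists>B. \<forall>g\<in>(\<lambda>t p. norm (\<eta> p t)) ` {0..}. g p \<le> B" for p
      using bounded[of p] by (auto simp: bounded_iff)
  qed (auto simp: \<eta>_eq levy_exponent_minus[OF \<nu>] norm_levy_exponent_add_le[OF \<nu> z, unfolded distrib_left]
        intro!: continuous_on_norm continuous_levy_exponent[OF \<nu>])
  then obtain C where C: "\<And>p t. 0 \<le> t \<Longrightarrow> norm (\<eta> p t) \<le> C * (1 + p\<^sup>2)"
    by auto
  \<comment> \<open>Regularity in p, as opposed to t, is read off the Levy-Khintchine form.\<close>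
  have meas: "(\<lambda>p. \<eta> p t) \<in> borel_measurable borel" if "0 \<le> t" for t
    using borel_measurable_continuous_onI[OF continuous_levy_exponent[OF \<nu>[OF that]]] \<eta>_eq[OF that]
    by simp
  note gen = generator_eqI[OF has_generator_value_fourier[OF char continuous C meas _ f]]
  show ?thesis
  proof (intro conjI allI impI)
    fix s t x :: real assume st: "0 \<le> s \<and> s \<le> t"
    interpret \<mu>: real_distribution "increment_law M X s t"
      using st by (intro real_distribution_increment_law) auto
    note law = \<mu>.propagate_schwartz[OF f, of x, unfolded char[OF conjunct1[OF st] conjunct2[OF st]]]
    show "integrable lborel
        (\<lambda>p. iexp (p * x) * exp (LINT \<tau>:{s..t}|lborel. \<eta> p \<tau>) * fourier f p)"
      by (rule law(1))
    show "propagator M X s t f x = complex_of_real (1 / sqrt (2 * pi)) *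
        (LINT p|lborel. iexp (p * x) * exp (LINT \<tau>:{s..t}|lborel. \<eta> p \<tau>) * fourier f p)"
      unfolding propagator_def by (rule law(2))
  next
    fix t :: real assume t: "0 \<le> t"
    show "f \<in> generator_domain M X t"
      by (rule gen(1)) (use t in auto)
    fix x
    show "integrable lborel (\<lambda>p. iexp (p * x) * \<eta> p t * fourier f p)"
      unfolding \<eta>_eq[OF t] by (rule levy_operator_schwartz(2)[OF f \<nu>[OF t]])
    show gen_x: "generator M X t f x = complex_of_real (1 / sqrt (2 * pi)) *
        (LINT p|lborel. iexp (p * x) * \<eta> p t * fourier f p)"
      by (subst gen(2)) (use t in auto)
    show "integrable (\<nu> t)
        (\<lambda>y. f (x + y) - f x - complex_of_real (y * indicator {-1..1} y) * vderiv 1 f x)"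
      by (rule levy_operator_schwartz(1)[OF f \<nu>[OF t]])
    show "generator M X t f x =
        complex_of_real (1/2 * z t) * vderiv 2 f x + complex_of_real (b t) * vderiv 1 f x
        + (LINT y|\<nu> t. f (x + y) - f x
             - complex_of_real (y * indicator {-1..1} y) * vderiv 1 f x)"
      \<comment> \<open>The generator is already known as a Fourier multiplier; the operator
        identity rewrites it as the integro-differential form.\<close>
      unfolding gen_x \<eta>_eq[OF t] by (rule levy_operator_schwartz(3)[OF f \<nu>[OF t], symmetric])
  qed
qed

end
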